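(* Let $H$ and $K$ be monoids, and let $f \colon \mathcal P(H) \to \mathcal P(K)$ be a semigroup isomorphism. Then the following hold: (i) $f(H^\times) = K^\times$, where $H^\times$ is regarded as an element of $\mathcal P(H)$ and $K^\times$ as an element of $\mathcal P(K)$. (ii) $f$ restricts to a semigroup isomorphism from $\mathcal P(H^\times)$ onto $\mathcal P(K^\times)$, where $\mathcal P(H^\times)$ and $\mathcal P(K^\times)$ are regarded as subsemigroups of $\mathcal P(H)$ and $\mathcal P(K)$, respectively.
   Context: For a semigroup $S$, the large power semigroup $\mathcal P(S)$ is the semigroup whose elements are all non-empty subsets of $S$ (finite or infinite), with the operation of setwise multiplication $AB := \{ab : a \in A,\, b \in B\}$. For a monoid $M$, $M^\times$ denotes the group of units (two-sided invertible elements) of $M$. *)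

theory Defs
  imports "HOL-Algebra.Coset"
begin

text \<open>
  The large power semigroup of \<open>S\<close>: all non-empty subsets of \<open>S\<close> under setwise multiplication.
  Semigroups are represented by monoid records, whose unit field plays no role in
  \<^const>\<open>hom\<close> and \<^const>\<open>iso\<close>; the latter are thus exactly the semigroup homomorphisms and
  isomorphisms. If \<open>S\<close> is a monoid then the unit chosen below is the identity of the power semigroup.
\<close>

definition power_semigroup :: "('a, 'm) monoid_scheme \<Rightarrow> 'a set monoid" where
  "power_semigroup S =
    \<lparr>carrier = {A. A \<subseteq> carrier S \<and> A \<noteq> {}}, mult = set_mult S, one = {\<one>\<^bsub>S\<^esub>}\<rparr>"

lemma monoid_power_semigroup:
  assumes "monoid S"
  shows "monoid (power_semigroup S)"
proof -
  interpret monoid S by fact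
  show ?thesis
  proof (rule monoidI, goal_cases)
    case (1 A B)
    then show ?case by (fastforce simp: power_semigroup_def set_mult_def)
  next
    case 2
    then show ?case by (simp add: power_semigroup_def)
  next
    case (3 A B C)
    then have "A \<subseteq> carrier S" "B \<subseteq> carrier S" "C \<subseteq> carrier S"
      by (auto simp: power_semigroup_def)
    then show ?case
      by (simp add: power_semigroup_def set_mult_def) (auto simp: m_assoc subset_iff)
  next
    case (4 A)
    then have "A \<subseteq> carrier S" by (simp add: power_semigroup_def)
    then have "(\<Union>k\<in>A. {\<one>\<^bsub>S\<^esub> \<otimes>\<^bsub>S\<^esub> k}) = (\<Union>k\<in>A. {k})"
      by (intro SUP_cong) auto
    then show ?case by (simp add: power_semigroup_def set_mult_def)
  next
    case (5 A)
    then have "A \<subseteq> carrier S" by (simp add: power_semigroup_def)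
    then have "(\<Union>h\<in>A. {h \<otimes>\<^bsub>S\<^esub> \<one>\<^bsub>S\<^esub>}) = (\<Union>h\<in>A. {h})"
      by (intro SUP_cong) auto
    then show ?case by (simp add: power_semigroup_def set_mult_def)
  qed
qed

text \<open>
  The power semigroup of the group of units is literally a subsemigroup of the power semigroup of
  the monoid: its carrier is contained in the larger one and its multiplication is the same function.
\<close>

lemma carrier_power_semigroup_units_subset:
  "carrier (power_semigroup (units_of M)) \<subseteq> carrier (power_semigroup M)"
  by (auto simp: power_semigroup_def units_of_def Units_def)

lemma mult_power_semigroup_units:
  "mult (power_semigroup (units_of M)) = mult (power_semigroup M)"
  by (simp add: power_semigroup_def units_of_def set_mult_def fun_eq_iff)

end

theory Submission
  imports Defs
begin

text \<open>
  A multiplicative bijection between monoids preserves identities, hence units, and the units of a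
  power semigroup are the singletons \<open>{u}\<close> with \<open>u\<close> a unit. So for a set \<open>A\<close> the condition
  \<open>M\<^sup>\<times> A = A\<close>, being equivalent to \<open>{u} A = A\<close> for every unit \<open>u\<close>, is preserved by \<open>f\<close> and its
  inverse, and likewise on the right. Let \<open>G\<close> be the preimage of \<open>K\<^sup>\<times>\<close>. Then \<open>H\<^sup>\<times> G = G\<close> and
  \<open>f(H\<^sup>\<times>) K\<^sup>\<times> = f(H\<^sup>\<times>)\<close>, and therefore \<open>f(H\<^sup>\<times>) = f(H\<^sup>\<times>) f(G) = f(H\<^sup>\<times> G) = f(G) = K\<^sup>\<times>\<close>. Finally,
  \<open>A \<subseteq> M\<^sup>\<times>\<close> holds if and only if \<open>A M\<^sup>\<times> = M\<^sup>\<times>\<close>, so \<open>f\<close> also respects the subsets of the unit groups.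
\<close>

text \<open>Closure of \<open>G\<close> under multiplication is what lets injectivity of
  \<open>h\<close> compare the two products. The lemma supplies the reverse inclusion in
  \<open>iso_image_Units\<close>.\<close>

lemma (in monoid) iso_inv_into:
  assumes "h \<in> iso G H"
  shows "inv_into (carrier G) h \<in> iso H G"
proof -
  let ?g = "inv_into (carrier G) h"
  have h: "h \<in> hom G H" "bij_betw h (carrier G) (carrier H)"
    using assms by (auto simp: iso_def)
  have g: "bij_betw ?g (carrier H) (carrier G)" by (rule bij_betw_inv_into[OF h(2)])
  have "?g (x \<otimes>\<^bsub>H\<^esub> y) = ?g x \<otimes> ?g y" if "x \<in> carrier H" "y \<in> carrier H" for x y
  proof -
    have in_G: "?g x \<in> carrier G" "?g y \<in> carrier G"
      using that g by (auto dest: bij_betwE)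
    then have "h (?g x \<otimes> ?g y) = x \<otimes>\<^bsub>H\<^esub> y"
      using hom_mult[OF h(1) in_G] that bij_betw_inv_into_right[OF h(2)] by simp
    then show ?thesis
      using bij_betw_inv_into_left[OF h(2) m_closed[OF in_G]] by simp
  qed
  then have "?g \<in> hom H G" using g by (auto intro!: homI dest: bij_betwE)
  with g show ?thesis by (simp add: iso_def)
qed

text \<open>Membership in \<open>hom\<close> says nothing about identities; surjectivity does the
  work: if \<open>f x\<close> is the identity of \<open>N\<close>, then it equals \<open>f\<close>
  of the identity of \<open>M\<close> times \<open>f x\<close>.\<close>

lemma iso_one:
  assumes "monoid M" "monoid N" "f \<in> iso M N"
  shows "f \<one>\<^bsub>M\<^esub> = \<one>\<^bsub>N\<^esub>"
proof -
  interpret M: monoid M by fact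
  interpret N: monoid N by fact
  have f: "f \<in> hom M N" "bij_betw f (carrier M) (carrier N)"
    using assms(3) by (auto simp: iso_def)
  obtain x where x: "x \<in> carrier M" "f x = \<one>\<^bsub>N\<^esub>"
    using f(2) N.one_closed by (metis bij_betw_iff_bijections)
  have "f \<one>\<^bsub>M\<^esub> = f \<one>\<^bsub>M\<^esub> \<otimes>\<^bsub>N\<^esub> f x"
    using x f(1) by (simp add: hom_in_carrier)
  also have "\<dots> = f x"
    using x hom_mult[OF f(1) M.one_closed x(1)] by simp
  finally show ?thesis using x by simp
qed

lemma iso_Units_subset:
  assumes "monoid M" "monoid N" "f \<in> iso M N"
  shows "f ` Units M \<subseteq> Units N"
proof -
  have hom: "f \<in> hom M N" using assms(3) by (simp add: iso_def)
  show ?thesis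
  proof
    fix y assume "y \<in> f ` Units M"
    then obtain x x' where "y = f x" "x \<in> carrier M" "x' \<in> carrier M"
      "x' \<otimes>\<^bsub>M\<^esub> x = \<one>\<^bsub>M\<^esub>" "x \<otimes>\<^bsub>M\<^esub> x' = \<one>\<^bsub>M\<^esub>"
      by (auto simp: Units_def)
    moreover from this have "f x' \<otimes>\<^bsub>N\<^esub> f x = \<one>\<^bsub>N\<^esub>" "f x \<otimes>\<^bsub>N\<^esub> f x' = \<one>\<^bsub>N\<^esub>"
      using iso_one[OF assms] hom_mult[OF hom] by metis+
    ultimately show "y \<in> Units N"
      unfolding Units_def using hom_in_carrier[OF hom] by blast
  qed
qed

lemma iso_image_Units:
  assumes "monoid M" "monoid N" "f \<in> iso M N"
  shows "f ` Units M = Units N"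
proof
  show "f ` Units M \<subseteq> Units N" by (rule iso_Units_subset[OF assms])
next
  interpret M: monoid M by fact
  interpret N: monoid N by fact
  let ?g = "inv_into (carrier M) f"
  have bij: "bij_betw f (carrier M) (carrier N)" using assms(3) by (simp add: iso_def)
  have "?g ` Units N \<subseteq> Units M"
    using iso_Units_subset[OF assms(2,1) M.iso_inv_into[OF assms(3)]] .
  moreover have "f (?g y) = y" if "y \<in> Units N" for y
    using bij_betw_inv_into_right[OF bij N.Units_closed[OF that]] .
  ultimately show "Units N \<subseteq> f ` Units M" by (metis image_eqI image_subset_iff subsetI)
qed

context monoid
begin

text \<open>If \<open>A\<close> and \<open>B\<close> are mutually inverse, any fixed
  \<open>b\<close> in \<open>B\<close> is a two-sided inverse of every element of \<open>A\<close>,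
  so uniqueness of inverses leaves \<open>A\<close> only one element.\<close>

lemma Units_power_semigroup:
  "Units (power_semigroup G) = (\<lambda>u. {u}) ` Units G"
proof (intro equalityI subsetI)
  fix A assume "A \<in> Units (power_semigroup G)"
  then obtain B where A: "A \<subseteq> carrier G" "A \<noteq> {}" and B: "B \<subseteq> carrier G" "B \<noteq> {}"
    and AB: "A <#> B = {\<one>}" and BA: "B <#> A = {\<one>}"
    by (auto simp: Units_def power_semigroup_def)
  obtain b where b: "b \<in> B" using B by blast
  have inv: "a \<otimes> b = \<one>" "b \<otimes> a = \<one>" if "a \<in> A" for a
    using AB BA that b by (auto simp: set_mult_def)
  obtain a where a: "a \<in> A" using A by blast
  have "a' = a" if "a' \<in> A" for a'
    using inv_unique[of a' b a] inv that a A B b by blast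
  then have "A = {a}" using a by blast
  moreover have "a \<in> Units G"
    using inv[OF a] a b A B by (auto simp: Units_def)
  ultimately show "A \<in> (\<lambda>u. {u}) ` Units G" by blast
next
  fix A assume "A \<in> (\<lambda>u. {u}) ` Units G"
  then obtain u where u: "u \<in> Units G" "A = {u}" by blast
  then have "{inv u} <#> A = {\<one>}" "A <#> {inv u} = {\<one>}"
    by (auto simp: set_mult_def)
  moreover have "A \<in> carrier (power_semigroup G)" "{inv u} \<in> carrier (power_semigroup G)"
    using u by (auto simp: power_semigroup_def)
  ultimately show "A \<in> Units (power_semigroup G)"
    unfolding Units_def by (auto simp: power_semigroup_def)
qed

text \<open>Reduces absorption of the whole unit group to translations by single units, which an
  isomorphism of power semigroups can track. The union of translates is non-empty because the
  identity is a unit.\<close>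

lemma Units_set_mult_eq:
  assumes "\<And>u. u \<in> Units G \<Longrightarrow> {u} <#> A = A"
  shows "Units G <#> A = A"
proof -
  have "Units G <#> A = (\<Union>u\<in>Units G. {u} <#> A)" by (auto simp: set_mult_def)
  also have "\<dots> = A" using assms Units_one_closed by blast
  finally show ?thesis .
qed

lemma set_mult_Units_eq:
  assumes "\<And>u. u \<in> Units G \<Longrightarrow> A <#> {u} = A"
  shows "A <#> Units G = A"
proof -
  have "A <#> Units G = (\<Union>u\<in>Units G. A <#> {u})" by (auto simp: set_mult_def)
  also have "\<dots> = A" using assms Units_one_closed by blast
  finally show ?thesis .
qed

text \<open>Turns containment in the unit group into an equation that \<open>f\<close> can
  transport. Multiplying by the identity gives one direction; \<open>u = a (inv a u)\<close> for a
  fixed \<open>a\<close> in \<open>A\<close> gives the other.\<close>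

lemma set_mult_Units_eq_Units_iff:
  assumes "A \<subseteq> carrier G" "A \<noteq> {}"
  shows "A <#> Units G = Units G \<longleftrightarrow> A \<subseteq> Units G"
proof
  assume eq: "A <#> Units G = Units G"
  show "A \<subseteq> Units G"
  proof
    fix a assume a: "a \<in> A"
    then have "a \<otimes> \<one> \<in> A <#> Units G" unfolding set_mult_def by blast
    with eq a assms show "a \<in> Units G" by auto
  qed
next
  assume A: "A \<subseteq> Units G"
  obtain a where a: "a \<in> A" using assms by blast
  have "u \<in> A <#> Units G" if u: "u \<in> Units G" for u
  proof -
    have "u = a \<otimes> (inv a \<otimes> u)" "inv a \<otimes> u \<in> Units G"
      using a A u by (auto simp: m_assoc[symmetric] Units_closed subset_iff)
    with a show ?thesis unfolding set_mult_def by blast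
  qed
  with A show "A <#> Units G = Units G" by (auto simp: set_mult_def)
qed

end

lemma iso_power_semigroup_Units:
  assumes "monoid H" "monoid K" and f: "f \<in> iso (power_semigroup H) (power_semigroup K)"
  shows "f (Units H) = Units K"
proof -
  interpret H: monoid H by fact
  interpret K: monoid K by fact
  let ?PH = "power_semigroup H" and ?PK = "power_semigroup K"
  have bij: "bij_betw f (carrier ?PH) (carrier ?PK)" and hom: "f \<in> hom ?PH ?PK"
    using f by (auto simp: iso_def)
  have mult: "f (A <#>\<^bsub>H\<^esub> B) = f A <#>\<^bsub>K\<^esub> f B"
    if "A \<in> carrier ?PH" "B \<in> carrier ?PH" for A B
    using hom_mult[OF hom that] by (simp add: power_semigroup_def)
  have closed: "A <#>\<^bsub>H\<^esub> B \<in> carrier ?PH" if "A \<in> carrier ?PH" "B \<in> carrier ?PH" for A B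
    using monoid.m_closed[OF monoid_power_semigroup[OF assms(1)] that]
    by (simp add: power_semigroup_def)
  have img: "f ` (\<lambda>u. {u}) ` Units H = (\<lambda>v. {v}) ` Units K"
    using iso_image_Units[OF monoid_power_semigroup monoid_power_semigroup f] assms
    by (simp add: H.Units_power_semigroup K.Units_power_semigroup)
  have sing: "{u} \<in> carrier ?PH" if "u \<in> Units H" for u
    using that by (auto simp: power_semigroup_def)
  have UH: "Units H \<in> carrier ?PH" and UK: "Units K \<in> carrier ?PK"
    using H.Units_one_closed K.Units_one_closed by (auto simp: power_semigroup_def)
  obtain G where G: "G \<in> carrier ?PH" "f G = Units K"
    using bij UK by (metis bij_betw_iff_bijections)
  \<comment> \<open>Absorption holds in \<open>K\<close>, where \<open>{v}\<close> fixes
    \<open>Units K\<close>, and is pulled back by injectivity of \<open>f\<close>.\<close>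
  have "Units H <#>\<^bsub>H\<^esub> G = G"
  proof (rule H.Units_set_mult_eq)
    fix u assume u: "u \<in> Units H"
    then obtain v where v: "v \<in> Units K" "f {u} = {v}" using img by blast
    have "f ({u} <#>\<^bsub>H\<^esub> G) = {v} <#>\<^bsub>K\<^esub> Units K"
      using mult[OF sing[OF u] G(1)] v G by simp
    also have "\<dots> = f G"
      using K.set_mult_Units_eq_Units_iff[of "{v}"] K.Units_closed[OF v(1)] v G by simp
    finally show "{u} <#>\<^bsub>H\<^esub> G = G"
      using bij closed[OF sing[OF u] G(1)] G(1) by (meson bij_betw_def inj_onD)
  qed
  \<comment> \<open>Here absorption holds in \<open>H\<close> and is pushed forward along
    \<open>f\<close>.\<close>
  moreover have "f (Units H) <#>\<^bsub>K\<^esub> Units K = f (Units H)"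
  proof (rule K.set_mult_Units_eq)
    fix v assume "v \<in> Units K"
    then have "{v} \<in> f ` (\<lambda>u. {u}) ` Units H" unfolding img by blast
    then obtain u where u: "u \<in> Units H" "{v} = f {u}" by blast
    \<comment> \<open>Mirror image of the singleton case of
      \<open>set_mult_Units_eq_Units_iff\<close>, with the unit now on the right.\<close>
    have "Units H <#>\<^bsub>H\<^esub> {u} = Units H"
    proof -
      have "w \<in> Units H <#>\<^bsub>H\<^esub> {u}" if w: "w \<in> Units H" for w
      proof -
        have "w = (w \<otimes>\<^bsub>H\<^esub> inv\<^bsub>H\<^esub> u) \<otimes>\<^bsub>H\<^esub> u"
          using u w by (simp add: H.m_assoc H.Units_closed)
        then show ?thesis unfolding set_mult_def using u w by blast
      qed
      then show ?thesis using u by (auto simp: set_mult_def)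
    qed
    then show "f (Units H) <#>\<^bsub>K\<^esub> {v} = f (Units H)"
      using mult[OF UH sing[OF u(1)]] u(2) by metis
  qed
  \<comment> \<open>\<open>f (Units H)\<close> times \<open>f G\<close> is \<open>f G\<close> by the
    first absorption and \<open>f (Units H)\<close> by the second.\<close>
  ultimately show ?thesis
    using mult[OF UH G(1)] G(2) by metis
qed

theorem theorem2p3:
  fixes H :: "('a, 'm) monoid_scheme" and K :: "('b, 'n) monoid_scheme"
    and f :: "'a set \<Rightarrow> 'b set"
  assumes "monoid H" and "monoid K"
    and "f \<in> iso (power_semigroup H) (power_semigroup K)"
  shows "f (Units H) = Units K \<and>
    f \<in> iso (power_semigroup (units_of H)) (power_semigroup (units_of K))"
proof
  interpret H: monoid H by fact
  interpret K: monoid K by fact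
  let ?PH = "power_semigroup H" and ?PK = "power_semigroup K"
  let ?UH = "power_semigroup (units_of H)" and ?UK = "power_semigroup (units_of K)"
  show U: "f (Units H) = Units K" by (rule iso_power_semigroup_Units[OF assms])
  have bij: "bij_betw f (carrier ?PH) (carrier ?PK)" and hom: "f \<in> hom ?PH ?PK"
    using assms(3) by (auto simp: iso_def)
  have UH: "Units H \<in> carrier ?PH"
    using H.Units_one_closed by (auto simp: power_semigroup_def)
  have carrier_UH: "A \<in> carrier ?UH \<longleftrightarrow> A <#>\<^bsub>H\<^esub> Units H = Units H" if "A \<in> carrier ?PH" for A
    using that H.set_mult_Units_eq_Units_iff[of A] by (auto simp: power_semigroup_def units_of_def)
  have carrier_UK: "B \<in> carrier ?UK \<longleftrightarrow> B <#>\<^bsub>K\<^esub> Units K = Units K" if "B \<in> carrier ?PK" for B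
    using that K.set_mult_Units_eq_Units_iff[of B] by (auto simp: power_semigroup_def units_of_def)
  \<comment> \<open>Both sides are absorption equations; \<open>f\<close> carries one to the other
    since it fits the unit groups together by \<open>U\<close>, and injectivity makes this an
    equivalence.\<close>
  have iff: "f A \<in> carrier ?UK \<longleftrightarrow> A \<in> carrier ?UH" if A: "A \<in> carrier ?PH" for A
  proof -
    have "A <#>\<^bsub>H\<^esub> Units H \<in> carrier ?PH"
      using monoid.m_closed[OF monoid_power_semigroup[OF assms(1)] A UH]
      by (simp add: power_semigroup_def)
    then have "A <#>\<^bsub>H\<^esub> Units H = Units H \<longleftrightarrow> f (A <#>\<^bsub>H\<^esub> Units H) = f (Units H)"
      using bij UH by (metis bij_betw_def inj_on_eq_iff)
    also have "\<dots> \<longleftrightarrow> f A <#>\<^bsub>K\<^esub> Units K = Units K"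
      using hom_mult[OF hom A UH] U by (simp add: power_semigroup_def)
    finally show ?thesis
      using carrier_UH[OF A] carrier_UK[OF hom_in_carrier[OF hom A]] by simp
  qed
  note sub = carrier_power_semigroup_units_subset[of H] carrier_power_semigroup_units_subset[of K]
  have "f ` carrier ?UH = carrier ?UK"
  proof (intro equalityI subsetI)
    fix B assume "B \<in> f ` carrier ?UH"
    then show "B \<in> carrier ?UK" using iff sub(1) by blast
  next
    fix B assume B: "B \<in> carrier ?UK"
    then obtain A where "A \<in> carrier ?PH" "f A = B"
      using bij sub(2) by (metis bij_betw_iff_bijections subsetD)
    then show "B \<in> f ` carrier ?UH" using iff B by blast
  qed
  then have "bij_betw f (carrier ?UH) (carrier ?UK)"
    using bij sub(1) by (metis bij_betw_subset)
  moreover have "f \<in> hom ?UH ?UK"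
  proof (rule homI)
    show "f A \<in> carrier ?UK" if "A \<in> carrier ?UH" for A
      using that iff sub(1) by blast
    show "f (A \<otimes>\<^bsub>?UH\<^esub> B) = f A \<otimes>\<^bsub>?UK\<^esub> f B" if "A \<in> carrier ?UH" "B \<in> carrier ?UH" for A B
      using that sub(1) hom_mult[OF hom, of A B]
      by (auto simp: mult_power_semigroup_units)
  qed
  ultimately show "f \<in> iso ?UH ?UK" by (simp add: iso_def)
qed

end
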